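(* Let $\gamma>1$ and $k_1,k_2,k_3>-1$. Consider a self-similar Riemann solution with initial data $U_L$ ($x<0$), $U_R$ ($x>0$) of the one-dimensional Euler equations with singular source $\partial_tU+\partial_xF(U)=\delta(x)S$ (precise definition in the context), whose stationary wave at $x=0$ has left-hand state $U_-$ and right-hand state $U_+$ with $u_->0$, $u_+>0$, satisfying the jump relation and the Monotonicity Criterion. Then the solution has one of the following seven structures. (i) Non-choked structures: Type 1: $\mathcal{W}(U_L,U_-)\oplus\mathcal{D}(U_-,U_+)\oplus\mathcal{C}(U_+,U_4)\oplus\mathcal{W}(U_4,U_R)$. Type 2: $\mathcal{D}(U_L,U_+)\oplus\mathcal{W}(U_+,U_3)\oplus\mathcal{C}(U_3,U_4)\oplus\mathcal{W}(U_4,U_R)$. (ii) Choked structures: Type 3: $\mathcal{W}(U_L,U_-)\oplus\mathcal{D}(U_-,U_+)\oplus\mathcal{R}(U_+,U_3)\oplus\mathcal{C}(U_3,U_4)\oplus\mathcal{W}(U_4,U_R)$ with $M_+=1$. Type 4: $\mathcal{D}(U_L,U_+)\oplus\mathcal{R}(U_+,U_3)\oplus\mathcal{C}(U_3,U_4)\oplus\mathcal{W}(U_4,U_R)$ with $M_+=1$. Type 5: $\mathcal{R}(U_L,U_-)\oplus\mathcal{D}(U_-,U_+)\oplus\mathcal{W}(U_+,U_3)\oplus\mathcal{C}(U_3,U_4)\oplus\mathcal{W}(U_4,U_R)$ with $M_-=1$. Type 6: $\mathcal{R}(U_L,U_-)\oplus\mathcal{D}(U_-,U_+)\oplus\mathcal{C}(U_+,U_4)\oplus\mathcal{W}(U_4,U_R)$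 with $M_-=1$. Type 7: $\mathcal{R}(U_L,U_-)\oplus\mathcal{D}(U_-,U_+)\oplus\mathcal{R}(U_+,U_3)\oplus\mathcal{C}(U_3,U_4)\oplus\mathcal{W}(U_4,U_R)$ with $M_-=M_+=1$.
   Context: Equations. $U=(\rho,\rho u,E)^T$, $F(U)=(\rho u,\rho u^2+p,(E+p)u)^T$, with $\rho>0$, $p>0$, polytropic ideal gas $E=\frac{p}{\gamma-1}+\frac12\rho u^2$, sound speed $a=\sqrt{\gamma p/\rho}$, Mach number $M=u/a$ (for $u>0$), eigenvalues of $\partial F/\partial U$: $\lambda_1=u-a$, $\lambda_2=u$, $\lambda_3=u+a$. $\delta$ is the Dirac delta at the origin. The source, when the velocities on both sides of $x=0$ are positive, is $S=\mathrm{diag}(k_1,k_2,k_3)F(U_-)$, where $U_-$ is the state on the left of the origin. Subscripts on $u,a,M,\dots$ refer to the corresponding state. Stationary wave. A discontinuity located on $x=0$ with left-hand state $U_-$ and right-hand state $U_+$ satisfying the jump relation $\rho_-u_-(1+k_1)=\rho_+u_+$, $(\rho_-u_-^2+p_-)(1+k_2)=\rho_+u_+^2+p_+$, $(E_-+p_-)u_-(1+k_3)=(E_++p_+)u_+$. Monotonicity Criterion: $\lambda_j(U_-)\lambda_j(U_+)\ge 0$ for $j=1,2,3$. The stationary wave (and the Riemann solution containing it) is called choked if $\lambda_j(U_-)\lambda_j(U_+)=0$ for some $j\in\{1,2,3\}$. Riemann solution (double classical Riemann problem form). A self-similar solution $U(x,t)=U(x/t)$ consisting of constant states separated by: a stationary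 wave at $x=0$ with states $U_-,U_+$; in the left half-plane, from $U_L$ to $U_-$ in order from left to right, a 1-wave, a 2-contact discontinuity and a 3-wave of the classical Euler equations $\partial_tU+\partial_xF(U)=0$, all travelling with nonpositive speeds; in the right half-plane, from $U_+$ to $U_R$ in order from left to right, a 1-wave, a 2-contact discontinuity and a 3-wave of the classical Euler equations, all travelling with nonnegative speeds. Any of the six classical waves may be absent (trivial). A 1-wave or 3-wave is either a Lax shock ($j$-shock of speed $\sigma$ from left state $V$ to right state $W$: $F(W)-F(V)=\sigma(W-V)$ and $\lambda_j(V)>\sigma>\lambda_j(W)$) or a centred rarefaction wave of the $j$-th family (whose speeds range over $[\lambda_j(V),\lambda_j(W)]$). A 2-contact discontinuity has equal $u$ and $p$ on both sides and speed $u$. Notation for structures. Waves are listed from left to right, joined by $\oplus$. $\mathcal{D}(V,W)$: $V$ and $W$ are joined by the stationary wave. $\mathcal{C}(V,W)$: $V$ and $W$ are joined by a 2-contact discontinuity. $\mathcal{R}(V,W)$: joined by a rarefaction wave; $\mathcal{W}(V,W)$: joined by a shock or a rarefaction wave. A $\mathcal{W}$ or $\mathcal{R}$ starting at $U_L$ or at $U_+$ is a 1-wave; $\mathcal{W}(U_4,U_R)$ is a 3-wave. Each of $\mathcal{W},\mathcal{R},\mathcal{C}$ may be trivial (equal states). $U_3,U_4$ are intermediate constant states; a structure beginning with $\mathcal{D}(U_L,U_+)$ means $U_-=U_L$, i.e. there is no wave in the left half-plane. *)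

theory Defs
  imports "HOL-Analysis.Analysis"
begin

(* Conserved variables U = (rho, rho u, E). *)
type_synonym state = "real ^ 3"

definition density :: "state \<Rightarrow> real" where
  "density U = U $ 1"

definition velocity :: "state \<Rightarrow> real" where
  "velocity U = U $ 2 / U $ 1"

definition energy :: "state \<Rightarrow> real" where
  "energy U = U $ 3"

(* The polytropic law E = p / (gamma - 1) + rho u^2 / 2, solved for p. *)
definition pressure :: "real \<Rightarrow> state \<Rightarrow> real" where
  "pressure \<gamma> U = (\<gamma> - 1) * (energy U - density U * (velocity U)\<^sup>2 / 2)"

definition physical :: "real \<Rightarrow> state \<Rightarrow> bool" where
  "physical \<gamma> U \<longleftrightarrow> density U > 0 \<and> pressure \<gamma> U > 0"

definition flux :: "real \<Rightarrow> state \<Rightarrow> state" where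
  "flux \<gamma> U = vector
     [density U * velocity U,
      density U * (velocity U)\<^sup>2 + pressure \<gamma> U,
      (energy U + pressure \<gamma> U) * velocity U]"

definition sound_speed :: "real \<Rightarrow> state \<Rightarrow> real" where
  "sound_speed \<gamma> U = sqrt (\<gamma> * pressure \<gamma> U / density U)"

definition mach :: "real \<Rightarrow> state \<Rightarrow> real" where
  "mach \<gamma> U = velocity U / sound_speed \<gamma> U"

(* The eigenvalues of the flux Jacobian; only j = 1, 2, 3 is meaningful. *)
definition eigval :: "real \<Rightarrow> nat \<Rightarrow> state \<Rightarrow> real" where
  "eigval \<gamma> j U =
     (if j = 1 then velocity U - sound_speed \<gamma> U
      else if j = 2 then velocity U
      else velocity U + sound_speed \<gamma> U)"

definition lax_shock :: "real \<Rightarrow> nat \<Rightarrow> state \<Rightarrow> state \<Rightarrow> real \<Rightarrow> bool" where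
  "lax_shock \<gamma> j V W \<sigma> \<longleftrightarrow>
     physical \<gamma> V \<and> physical \<gamma> W \<and>
     flux \<gamma> W - flux \<gamma> V = \<sigma> *\<^sub>R (W - V) \<and>
     eigval \<gamma> j V > \<sigma> \<and> \<sigma> > eigval \<gamma> j W"

(* phi is the profile of the wave in the variable xi = x / t.  For a self-similar function the
   equation U_t + F(U)_x = 0 reads (F o phi)' = xi phi', i.e. phi' is an eigenvector of the flux
   Jacobian for the eigenvalue xi; the wave is of the j-th family if that eigenvalue is the j-th. *)
definition rarefaction :: "real \<Rightarrow> nat \<Rightarrow> state \<Rightarrow> state \<Rightarrow> (real \<Rightarrow> state) \<Rightarrow> bool" where
  "rarefaction \<gamma> j V W \<phi> \<longleftrightarrow>
     eigval \<gamma> j V < eigval \<gamma> j W \<and>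
     \<phi> (eigval \<gamma> j V) = V \<and> \<phi> (eigval \<gamma> j W) = W \<and>
     (\<forall>\<xi>\<in>{eigval \<gamma> j V..eigval \<gamma> j W}.
        physical \<gamma> (\<phi> \<xi>) \<and> eigval \<gamma> j (\<phi> \<xi>) = \<xi> \<and>
        (\<exists>d. (\<phi> has_vector_derivative d)
                (at \<xi> within {eigval \<gamma> j V..eigval \<gamma> j W}) \<and>
             ((\<lambda>\<eta>. flux \<gamma> (\<phi> \<eta>)) has_vector_derivative \<xi> *\<^sub>R d)
                (at \<xi> within {eigval \<gamma> j V..eigval \<gamma> j W})))"

definition contact :: "real \<Rightarrow> state \<Rightarrow> state \<Rightarrow> bool" where
  "contact \<gamma> V W \<longleftrightarrow>
     physical \<gamma> V \<and> physical \<gamma> W \<and> V \<noteq> W \<and>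
     velocity V = velocity W \<and> pressure \<gamma> V = pressure \<gamma> W"

definition stationary_jump ::
  "real \<Rightarrow> real \<Rightarrow> real \<Rightarrow> real \<Rightarrow> state \<Rightarrow> state \<Rightarrow> bool" where
  "stationary_jump \<gamma> k1 k2 k3 V W \<longleftrightarrow>
     physical \<gamma> V \<and> physical \<gamma> W \<and>
     density V * velocity V * (1 + k1) = density W * velocity W \<and>
     (density V * (velocity V)\<^sup>2 + pressure \<gamma> V) * (1 + k2)
       = density W * (velocity W)\<^sup>2 + pressure \<gamma> W \<and>
     (energy V + pressure \<gamma> V) * velocity V * (1 + k3)
       = (energy W + pressure \<gamma> W) * velocity W"

definition monotonicity_criterion :: "real \<Rightarrow> state \<Rightarrow> state \<Rightarrow> bool" where
  "monotonicity_criterion \<gamma> V W \<longleftrightarrow> (\<forall>j\<in>{1, 2, 3}. eigval \<gamma> j V * eigval \<gamma> j W \<ge> 0)"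

definition choked :: "real \<Rightarrow> state \<Rightarrow> state \<Rightarrow> bool" where
  "choked \<gamma> V W \<longleftrightarrow> (\<exists>j\<in>{1, 2, 3}. eigval \<gamma> j V * eigval \<gamma> j W = 0)"

(* The arguments are: family (shocks and rarefactions only), left state, right state, and the
   speed of a shock or the profile of a rarefaction. *)
datatype wave =
    Shock nat state state real
  | Rarefaction nat state state "real \<Rightarrow> state"
  | Contact state state
  | Stationary state state

fun right_state :: "wave \<Rightarrow> state" where
  "right_state (Shock j V W \<sigma>) = W"
| "right_state (Rarefaction j V W \<phi>) = W"
| "right_state (Contact V W) = W"
| "right_state (Stationary V W) = W"

fun min_speed :: "real \<Rightarrow> wave \<Rightarrow> real" where
  "min_speed \<gamma> (Shock j V W \<sigma>) = \<sigma>"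
| "min_speed \<gamma> (Rarefaction j V W \<phi>) = eigval \<gamma> j V"
| "min_speed \<gamma> (Contact V W) = velocity V"
| "min_speed \<gamma> (Stationary V W) = 0"

fun max_speed :: "real \<Rightarrow> wave \<Rightarrow> real" where
  "max_speed \<gamma> (Shock j V W \<sigma>) = \<sigma>"
| "max_speed \<gamma> (Rarefaction j V W \<phi>) = eigval \<gamma> j W"
| "max_speed \<gamma> (Contact V W) = velocity V"
| "max_speed \<gamma> (Stationary V W) = 0"

(* A structure is the set of all lists of nontrivial waves, read from left to right, that
   conform to it; a trivial wave contributes the empty list. *)

definition struct_append :: "wave list set \<Rightarrow> wave list set \<Rightarrow> wave list set"
    (infixr "\<oplus>" 65) where
  "S \<oplus> T = {xs @ ys |xs ys. xs \<in> S \<and> ys \<in> T}"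

definition \<R> :: "real \<Rightarrow> nat \<Rightarrow> state \<Rightarrow> state \<Rightarrow> wave list set" where
  "\<R> \<gamma> j V W = {xs. xs = [] \<and> V = W} \<union>
     {[Rarefaction j V W \<phi>] |\<phi>. rarefaction \<gamma> j V W \<phi>}"

definition \<W> :: "real \<Rightarrow> nat \<Rightarrow> state \<Rightarrow> state \<Rightarrow> wave list set" where
  "\<W> \<gamma> j V W = \<R> \<gamma> j V W \<union> {[Shock j V W \<sigma>] |\<sigma>. lax_shock \<gamma> j V W \<sigma>}"

definition \<C> :: "real \<Rightarrow> state \<Rightarrow> state \<Rightarrow> wave list set" where
  "\<C> \<gamma> V W = {xs. xs = [] \<and> V = W} \<union>
     {xs. xs = [Contact V W] \<and> contact \<gamma> V W}"

definition \<D> :: "real \<Rightarrow> real \<Rightarrow> real \<Rightarrow> real \<Rightarrow> state \<Rightarrow> state \<Rightarrow> wave list set" where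
  "\<D> \<gamma> k1 k2 k3 V W = {xs. xs = [Stationary V W] \<and> stationary_jump \<gamma> k1 k2 k3 V W}"

(* The self-similar function of xi = x / t determined by the leftmost state and the waves,
   ordered by speed.  Only rarefactions have min_speed < max_speed. *)
fun fan_profile :: "real \<Rightarrow> state \<Rightarrow> wave list \<Rightarrow> real \<Rightarrow> state" where
  "fan_profile \<gamma> V [] \<xi> = V"
| "fan_profile \<gamma> V (w # ws) \<xi> =
     (if \<xi> < min_speed \<gamma> w then V
      else if \<xi> < max_speed \<gamma> w
        then (case w of Rarefaction j V' W \<phi> \<Rightarrow> \<phi> \<xi> | _ \<Rightarrow> right_state w)
      else fan_profile \<gamma> (right_state w) ws \<xi>)"

(* U(x,t) has Riemann data UL, UR and consists of constant states separated by the waves ws;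
   its values on the lines of discontinuity are irrelevant. *)
definition consists_of ::
  "real \<Rightarrow> state \<Rightarrow> state \<Rightarrow> (real \<Rightarrow> real \<Rightarrow> state) \<Rightarrow> wave list \<Rightarrow> bool" where
  "consists_of \<gamma> UL UR U ws \<longleftrightarrow>
     (\<forall>x<0. U x 0 = UL) \<and> (\<forall>x>0. U x 0 = UR) \<and>
     sorted_wrt (\<lambda>w w'. max_speed \<gamma> w \<le> min_speed \<gamma> w') ws \<and>
     (\<forall>x. \<forall>t>0. (\<forall>w\<in>set ws. min_speed \<gamma> w = max_speed \<gamma> w \<longrightarrow> x / t \<noteq> min_speed \<gamma> w) \<longrightarrow>
        U x t = fan_profile \<gamma> UL ws (x / t))"

(* Double classical Riemann problem form.  The wave list is part of the data because a wave of
   speed zero is superposed on the stationary wave, so that U alone does not show Um and Up. *)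
definition riemann_solution ::
  "real \<Rightarrow> real \<Rightarrow> real \<Rightarrow> real \<Rightarrow> state \<Rightarrow> state \<Rightarrow> state \<Rightarrow> state \<Rightarrow>
   (real \<Rightarrow> real \<Rightarrow> state) \<Rightarrow> wave list \<Rightarrow> bool" where
  "riemann_solution \<gamma> k1 k2 k3 UL UR Um Up U ws \<longleftrightarrow>
     (\<exists>U1 U2 U3 U4.
      \<exists>wl \<in> \<W> \<gamma> 1 UL U1 \<oplus> \<C> \<gamma> U1 U2 \<oplus> \<W> \<gamma> 3 U2 Um.
      \<exists>wd \<in> \<D> \<gamma> k1 k2 k3 Um Up.
      \<exists>wr \<in> \<W> \<gamma> 1 Up U3 \<oplus> \<C> \<gamma> U3 U4 \<oplus> \<W> \<gamma> 3 U4 UR.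
        ws = wl @ wd @ wr \<and>
        (\<forall>w\<in>set wl. max_speed \<gamma> w \<le> 0) \<and>
        (\<forall>w\<in>set wr. min_speed \<gamma> w \<ge> 0)) \<and>
     consists_of \<gamma> UL UR U ws"

end

theory Submission imports Defs
begin

text \<open>Only the sign of the 1-eigenvalue \<open>u - a\<close> matters. Since \<open>u > 0\<close> at the left trace of the
stationary wave, a 2-wave or a 3-wave ending there would have positive speed, so the left half-plane
contains at most a 1-wave. A nontrivial 1-wave on the left with nonpositive speed forces
\<open>u - a \<le> 0\<close> at the left trace, strictly for a shock; a nontrivial 1-wave on the right with
nonnegative speed forces \<open>u - a \<ge> 0\<close> at the right trace, strictly for a shock. The monotonicity
criterion makes the two signs agree, and \<open>u - a = 0\<close> means Mach number one. In the choked case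
Type 5 (if \<open>u - a\<close> vanishes on the left) or Type 3 (if it vanishes on the right) already covers
every possibility; Types 4, 6 and 7 are special cases of these.\<close>

lemma struct_appendE:
  assumes "ws \<in> S \<oplus> T"
  obtains xs ys where "ws = xs @ ys" "xs \<in> S" "ys \<in> T"
  using assms by (auto simp: struct_append_def)

lemma struct_appendI: "xs \<in> S \<Longrightarrow> ys \<in> T \<Longrightarrow> xs @ ys \<in> S \<oplus> T"
  by (auto simp: struct_append_def)

lemma sound_speed_pos: "\<gamma> > 1 \<Longrightarrow> physical \<gamma> V \<Longrightarrow> sound_speed \<gamma> V > 0"
  by (simp add: sound_speed_def physical_def)

lemma mach_eq_1_iff:
  assumes "\<gamma> > 1" "physical \<gamma> V"
  shows "mach \<gamma> V = 1 \<longleftrightarrow> eigval \<gamma> 1 V = 0"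
  using sound_speed_pos[OF assms] by (auto simp: mach_def eigval_def)

lemma eigval_3_pos:
  assumes "\<gamma> > 1" "physical \<gamma> V" "velocity V > 0"
  shows "eigval \<gamma> 3 V > 0"
  using sound_speed_pos[OF assms(1,2)] assms(3) by (simp add: eigval_def)

text \<open>Positive velocities keep the second and third eigenvalues positive on both sides, so
  only the first family can vanish.\<close>

lemma choked_iff_eigval_1:
  assumes "\<gamma> > 1" "physical \<gamma> V" "physical \<gamma> W" "velocity V > 0" "velocity W > 0"
  shows "choked \<gamma> V W \<longleftrightarrow> eigval \<gamma> 1 V = 0 \<or> eigval \<gamma> 1 W = 0"
proof -
  have "eigval \<gamma> 2 V \<noteq> 0" "eigval \<gamma> 2 W \<noteq> 0"
    using assms by (auto simp: eigval_def)
  moreover have "eigval \<gamma> 3 V \<noteq> 0" "eigval \<gamma> 3 W \<noteq> 0"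
    using assms by (auto dest: eigval_3_pos)
  ultimately show ?thesis
    by (simp add: choked_def)
qed

text \<open>A rarefaction is fastest at its right edge, where its speed is the eigenvalue at
  \<open>W\<close>. For a shock the Lax inequality puts that eigenvalue strictly below the speed;
  this strictness later excludes shocks next to a sonic state.\<close>

lemma \<W>_nonpos_speed_cases:
  assumes "xs \<in> \<W> \<gamma> j V W" "\<forall>w\<in>set xs. max_speed \<gamma> w \<le> 0"
  obtains (trivial) "xs = []" "V = W"
  | (rarefaction) "xs \<in> \<R> \<gamma> j V W" "eigval \<gamma> j W \<le> 0"
  | (shock) "eigval \<gamma> j W < 0"
  using assms by (fastforce simp: \<W>_def \<R>_def lax_shock_def)

text \<open>Mirror image: the slowest edge of a rarefaction and the other Lax inequality control the
  eigenvalue at the left state \<open>V\<close>.\<close>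

lemma \<W>_nonneg_speed_cases:
  assumes "xs \<in> \<W> \<gamma> j V W" "\<forall>w\<in>set xs. min_speed \<gamma> w \<ge> 0"
  obtains (trivial) "xs = []" "V = W"
  | (rarefaction) "xs \<in> \<R> \<gamma> j V W" "eigval \<gamma> j V \<ge> 0"
  | (shock) "eigval \<gamma> j V > 0"
  using assms by (fastforce simp: \<W>_def \<R>_def lax_shock_def)

lemma left_waves_are_1_wave:
  assumes "\<gamma> > 1" "physical \<gamma> Um" "velocity Um > 0"
    and wl: "wl \<in> \<W> \<gamma> 1 UL U1 \<oplus> \<C> \<gamma> U1 U2 \<oplus> \<W> \<gamma> 3 U2 Um"
    and speed: "\<forall>w\<in>set wl. max_speed \<gamma> w \<le> 0"
  shows "wl \<in> \<W> \<gamma> 1 UL Um"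
proof -
  obtain w1 w2 w3 where wl_eq: "wl = w1 @ w2 @ w3" and w1: "w1 \<in> \<W> \<gamma> 1 UL U1"
    and w2: "w2 \<in> \<C> \<gamma> U1 U2" and w3: "w3 \<in> \<W> \<gamma> 3 U2 Um"
    using wl by (elim struct_appendE) blast
  \<comment> \<open>The 3-wave is removed first, because this identifies \<open>U2\<close> with
    \<open>Um\<close>. A contact would then move with the positive velocity of
    \<open>Um\<close>.\<close>
  have "\<forall>w\<in>set w3. max_speed \<gamma> w \<le> 0"
    using speed wl_eq by simp
  with w3 have "w3 = [] \<and> U2 = Um"
    using eigval_3_pos[OF assms(1-3)] by (cases rule: \<W>_nonpos_speed_cases) auto
  moreover from this have "w2 = [] \<and> U1 = Um"
    using w2 speed assms(3) by (auto simp: wl_eq \<C>_def contact_def)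
  ultimately show ?thesis
    using w1 wl_eq by simp
qed

theorem theorem3p1:
  fixes \<gamma> k1 k2 k3 :: real
    and UL UR Um Up :: state
    and U :: "real \<Rightarrow> real \<Rightarrow> state"
    and ws :: "wave list"
  assumes "\<gamma> > 1" and "k1 > -1" and "k2 > -1" and "k3 > -1"
    and "riemann_solution \<gamma> k1 k2 k3 UL UR Um Up U ws"
    and "velocity Um > 0" and "velocity Up > 0"
    and "monotonicity_criterion \<gamma> Um Up"
  shows
    "\<not> choked \<gamma> Um Up \<and>
       ((\<exists>U4. ws \<in> \<W> \<gamma> 1 UL Um \<oplus> \<D> \<gamma> k1 k2 k3 Um Up \<oplus> \<C> \<gamma> Up U4 \<oplus> \<W> \<gamma> 3 U4 UR)
      \<or> (Um = UL \<and>
         (\<exists>U3 U4. ws \<in> \<D> \<gamma> k1 k2 k3 UL Up \<oplus> \<W> \<gamma> 1 Up U3 \<oplus> \<C> \<gamma> U3 U4 \<oplus> \<W> \<gamma> 3 U4 UR)))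
   \<or> choked \<gamma> Um Up \<and>
       ((mach \<gamma> Up = 1 \<and>
         (\<exists>U3 U4. ws \<in> \<W> \<gamma> 1 UL Um \<oplus> \<D> \<gamma> k1 k2 k3 Um Up \<oplus> \<R> \<gamma> 1 Up U3 \<oplus>
                         \<C> \<gamma> U3 U4 \<oplus> \<W> \<gamma> 3 U4 UR))
      \<or> (mach \<gamma> Up = 1 \<and> Um = UL \<and>
         (\<exists>U3 U4. ws \<in> \<D> \<gamma> k1 k2 k3 UL Up \<oplus> \<R> \<gamma> 1 Up U3 \<oplus>
                         \<C> \<gamma> U3 U4 \<oplus> \<W> \<gamma> 3 U4 UR))
      \<or> (mach \<gamma> Um = 1 \<and>
         (\<exists>U3 U4. ws \<in> \<R> \<gamma> 1 UL Um \<oplus> \<D> \<gamma> k1 k2 k3 Um Up \<oplus> \<W> \<gamma> 1 Up U3 \<oplus>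
                         \<C> \<gamma> U3 U4 \<oplus> \<W> \<gamma> 3 U4 UR))
      \<or> (mach \<gamma> Um = 1 \<and>
         (\<exists>U4. ws \<in> \<R> \<gamma> 1 UL Um \<oplus> \<D> \<gamma> k1 k2 k3 Um Up \<oplus>
                      \<C> \<gamma> Up U4 \<oplus> \<W> \<gamma> 3 U4 UR))
      \<or> (mach \<gamma> Um = 1 \<and> mach \<gamma> Up = 1 \<and>
         (\<exists>U3 U4. ws \<in> \<R> \<gamma> 1 UL Um \<oplus> \<D> \<gamma> k1 k2 k3 Um Up \<oplus> \<R> \<gamma> 1 Up U3 \<oplus>
                         \<C> \<gamma> U3 U4 \<oplus> \<W> \<gamma> 3 U4 UR)))"
proof -
  obtain U1 U2 U3 U4 wl wd wr
    where wl': "wl \<in> \<W> \<gamma> 1 UL U1 \<oplus> \<C> \<gamma> U1 U2 \<oplus> \<W> \<gamma> 3 U2 Um"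
      and wd: "wd \<in> \<D> \<gamma> k1 k2 k3 Um Up"
      and wr: "wr \<in> \<W> \<gamma> 1 Up U3 \<oplus> \<C> \<gamma> U3 U4 \<oplus> \<W> \<gamma> 3 U4 UR"
      and ws: "ws = wl @ wd @ wr"
      and speed_l: "\<forall>w\<in>set wl. max_speed \<gamma> w \<le> 0"
      and speed_r: "\<forall>w\<in>set wr. min_speed \<gamma> w \<ge> 0"
    using assms(5) unfolding riemann_solution_def by blast
  have phys: "physical \<gamma> Um" "physical \<gamma> Up"
    using wd by (auto simp: \<D>_def stationary_jump_def)
  have wl: "wl \<in> \<W> \<gamma> 1 UL Um"
    using left_waves_are_1_wave[OF assms(1) phys(1) assms(6) wl' speed_l] .
  obtain w1 w2 w3 where wr_eq: "wr = w1 @ w2 @ w3" and w1: "w1 \<in> \<W> \<gamma> 1 Up U3"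
    and w2: "w2 \<in> \<C> \<gamma> U3 U4" and w3: "w3 \<in> \<W> \<gamma> 3 U4 UR"
    using wr by (elim struct_appendE) blast
  have speed_1: "\<forall>w\<in>set w1. min_speed \<gamma> w \<ge> 0"
    using speed_r wr_eq by simp
  have choked: "choked \<gamma> Um Up \<longleftrightarrow> eigval \<gamma> 1 Um = 0 \<or> eigval \<gamma> 1 Up = 0"
    using choked_iff_eigval_1[OF assms(1) phys assms(6,7)] .
  have same_sign: "eigval \<gamma> 1 Um * eigval \<gamma> 1 Up \<ge> 0"
    using assms(8) by (simp add: monotonicity_criterion_def)
  \<comment> \<open>The sonic cases may overlap; a doubly sonic solution can be treated in either
    one.\<close>
  consider (sonic_left) "eigval \<gamma> 1 Um = 0" | (sonic_right) "eigval \<gamma> 1 Up = 0"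
    | (subsonic) "eigval \<gamma> 1 Um < 0" "eigval \<gamma> 1 Up < 0"
    | (supersonic) "eigval \<gamma> 1 Um > 0" "eigval \<gamma> 1 Up > 0"
    using same_sign by (auto simp: order_le_less zero_less_mult_iff)
  then show ?thesis
  proof cases
    case sonic_left
    \<comment> \<open>A shock would make the eigenvalue at \<open>Um\<close> negative, and a trivial
      wave counts as a rarefaction: Type 5.\<close>
    from wl speed_l have "wl \<in> \<R> \<gamma> 1 UL Um"
      by (cases rule: \<W>_nonpos_speed_cases) (use sonic_left in \<open>auto simp: \<R>_def\<close>)
    then have "ws \<in> \<R> \<gamma> 1 UL Um \<oplus> \<D> \<gamma> k1 k2 k3 Um Up \<oplus> \<W> \<gamma> 1 Up U3 \<oplus> \<C> \<gamma> U3 U4 \<oplus> \<W> \<gamma> 3 U4 UR"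
      unfolding ws by (intro struct_appendI wd wr)
    moreover have "mach \<gamma> Um = 1"
      using mach_eq_1_iff[OF assms(1) phys(1)] sonic_left by simp
    moreover have "choked \<gamma> Um Up"
      using choked sonic_left by simp
    ultimately show ?thesis by blast
  next
    case sonic_right
    from w1 speed_1 have "w1 \<in> \<R> \<gamma> 1 Up U3"
      by (cases rule: \<W>_nonneg_speed_cases) (use sonic_right in \<open>auto simp: \<R>_def\<close>)
    then have "ws \<in> \<W> \<gamma> 1 UL Um \<oplus> \<D> \<gamma> k1 k2 k3 Um Up \<oplus> \<R> \<gamma> 1 Up U3 \<oplus> \<C> \<gamma> U3 U4 \<oplus> \<W> \<gamma> 3 U4 UR"
      unfolding ws wr_eq by (intro struct_appendI wl wd w2 w3)
    moreover have "mach \<gamma> Up = 1"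
      using mach_eq_1_iff[OF assms(1) phys(2)] sonic_right by simp
    moreover have "choked \<gamma> Um Up"
      using choked sonic_right by simp
    ultimately show ?thesis by blast
  next
    case subsonic
    \<comment> \<open>Any nontrivial 1-wave on the right needs a nonnegative first eigenvalue at
      \<open>Up\<close>. Hence the contact starts at \<open>Up\<close>: Type 1.\<close>
    from w1 speed_1 have "w1 = [] \<and> Up = U3"
      by (cases rule: \<W>_nonneg_speed_cases) (use subsonic in auto)
    then have wr_eq': "wr = w2 @ w3" and w2': "w2 \<in> \<C> \<gamma> Up U4"
      using wr_eq w2 by simp_all
    have "ws \<in> \<W> \<gamma> 1 UL Um \<oplus> \<D> \<gamma> k1 k2 k3 Um Up \<oplus> \<C> \<gamma> Up U4 \<oplus> \<W> \<gamma> 3 U4 UR"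
      unfolding ws wr_eq' by (intro struct_appendI wl wd w2' w3)
    moreover have "\<not> choked \<gamma> Um Up"
      using choked subsonic by simp
    ultimately show ?thesis by blast
  next
    case supersonic
    \<comment> \<open>Any nontrivial 1-wave on the left needs a nonpositive first eigenvalue at
      \<open>Um\<close>, so the left half-plane is constant: Type 2.\<close>
    from wl speed_l have left: "wl = [] \<and> UL = Um"
      by (cases rule: \<W>_nonpos_speed_cases) (use supersonic in auto)
    have "wd @ wr \<in> \<D> \<gamma> k1 k2 k3 Um Up \<oplus> \<W> \<gamma> 1 Up U3 \<oplus> \<C> \<gamma> U3 U4 \<oplus> \<W> \<gamma> 3 U4 UR"
      by (intro struct_appendI wd wr)
    then have "ws \<in> \<D> \<gamma> k1 k2 k3 UL Up \<oplus> \<W> \<gamma> 1 Up U3 \<oplus> \<C> \<gamma> U3 U4 \<oplus> \<W> \<gamma> 3 U4 UR"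
      using ws left by simp
    moreover have "\<not> choked \<gamma> Um Up"
      using choked supersonic by simp
    ultimately show ?thesis using left by blast
  qed
qed

end
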